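(* Let $B$ be a skew brace. Then $\theta_f(B)=\lambda_f(B)\cap FC(B,+)$, and $\theta_f(B)$ is a strong left ideal of $B$. Moreover, if $C$ is a skew brace and $\varphi:B\to C$ is a skew brace epimorphism, then $\varphi(\theta_f(B))\subseteq\theta_f(C)$.
   Context: A skew brace is a triple $(B,+,\circ)$ where $(B,+)$ and $(B,\circ)$ are (not necessarily abelian) groups with $a\circ(b+c)=a\circ b-a+a\circ c$ for all $a,b,c\in B$, where $-a$ is the inverse of $a$ in $(B,+)$ and $\circ$ takes precedence over $+$. Put $\lambda_a(b)=-a+a\circ b$ and $\theta_{(a,b)}(c)=a+\lambda_b(c)-a$. Define $\lambda_f(B)=\{x\in B: \{\lambda_a(x):a\in B\}\text{ is finite}\}$ and $\theta_f(B)=\{x\in B:\{\theta_{(a,b)}(x):a,b\in B\}\text{ is finite}\}$. $FC(B,+)$ is the set of elements of $B$ having finitely many conjugates in the group $(B,+)$. A strong left ideal is a normal subgroup $L$ of $(B,+)$ with $\lambda_b(L)=L$ for all $b\in B$. A skew brace morphism is a map that is a homomorphism of both additive and multiplicative groups; an epimorphism is a surjective morphism. *)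

theory Defs
  imports "HOL-Algebra.Coset" "HOL-Algebra.Ring"
begin

text \<open>
  A skew brace \<open>(B, +, \<circ>)\<close> is encoded in the record type of rings: \<open>\<oplus>\<close> is \<open>+\<close> (not assumed
  commutative) and \<open>\<otimes>\<close> is \<open>\<circ>\<close>. The fields \<open>\<zero>\<close> and \<open>\<one>\<close> are not extra data: they are determined
  as the neutral elements of the two groups.
\<close>

locale skew_brace = group B + add: group "add_monoid B" for B (structure) +
  assumes skew_distrib:
    "\<lbrakk>a \<in> carrier B; b \<in> carrier B; c \<in> carrier B\<rbrakk>
      \<Longrightarrow> a \<otimes> (b \<oplus> c) = (a \<otimes> b \<ominus> a) \<oplus> a \<otimes> c"

definition brace_lambda :: "('a, 'm) ring_scheme \<Rightarrow> 'a \<Rightarrow> 'a \<Rightarrow> 'a" where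
  "brace_lambda B a b = \<ominus>\<^bsub>B\<^esub> a \<oplus>\<^bsub>B\<^esub> a \<otimes>\<^bsub>B\<^esub> b"

definition brace_theta :: "('a, 'm) ring_scheme \<Rightarrow> 'a \<times> 'a \<Rightarrow> 'a \<Rightarrow> 'a" where
  "brace_theta B = (\<lambda>(a, b) c. (a \<oplus>\<^bsub>B\<^esub> brace_lambda B b c) \<ominus>\<^bsub>B\<^esub> a)"

definition lambda_f :: "('a, 'm) ring_scheme \<Rightarrow> 'a set" where
  "lambda_f B = {x \<in> carrier B. finite {brace_lambda B a x | a. a \<in> carrier B}}"

definition theta_f :: "('a, 'm) ring_scheme \<Rightarrow> 'a set" where
  "theta_f B =
    {x \<in> carrier B. finite {brace_theta B (a, b) x | a b. a \<in> carrier B \<and> b \<in> carrier B}}"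

definition FC :: "('a, 'm) monoid_scheme \<Rightarrow> 'a set" where
  "FC G = {x \<in> carrier G. finite {g \<otimes>\<^bsub>G\<^esub> x \<otimes>\<^bsub>G\<^esub> inv\<^bsub>G\<^esub> g | g. g \<in> carrier G}}"

definition strong_left_ideal :: "'a set \<Rightarrow> ('a, 'm) ring_scheme \<Rightarrow> bool" where
  "strong_left_ideal L B \<longleftrightarrow>
    L \<lhd> add_monoid B \<and> (\<forall>b \<in> carrier B. brace_lambda B b ` L = L)"

definition brace_hom :: "('a, 'm) ring_scheme \<Rightarrow> ('b, 'n) ring_scheme \<Rightarrow> ('a \<Rightarrow> 'b) set" where
  "brace_hom B C = hom (add_monoid B) (add_monoid C) \<inter> hom B C"

definition brace_epi :: "('a, 'm) ring_scheme \<Rightarrow> ('b, 'n) ring_scheme \<Rightarrow> ('a \<Rightarrow> 'b) set" where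
  "brace_epi B C = {\<phi> \<in> brace_hom B C. \<phi> ` carrier B = carrier C}"

end

theory Submission
  imports Defs
begin

text \<open>
  The maps \<open>\<theta>_(a,b)\<close> are an action of the semidirect product \<open>(B,+) \<rtimes>\<^sub>\<lambda> (B,\<circ>)\<close> on \<open>(B,+)\<close> by
  automorphisms: additivity of each \<open>\<theta>_(a,b)\<close> is \<open>theta_add\<close>, and the composition law is
  \<open>theta_theta\<close>.  Both rest on the fact that \<open>\<lambda>\<close> is an action of \<open>(B,\<circ>)\<close> on \<open>(B,+)\<close> by
  automorphisms (\<open>lambda_add\<close>, \<open>lambda_mult\<close>).  Thus \<open>\<theta>_f(B)\<close> is the set of elements with a finite
  orbit, and three facts on orbits give the result.

  The conjugacy class and the \<open>\<lambda>\<close>-orbit of \<open>x\<close> are contained in its \<open>\<theta>\<close>-orbit.  Conversely the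
  \<open>\<theta>\<close>-orbit is the union of the conjugacy classes of the points \<open>\<lambda>_b(x)\<close>; there are finitely many
  such points if \<open>x \<in> \<lambda>_f(B)\<close>, and the automorphism \<open>\<lambda>_b\<close> maps the class of \<open>x\<close> onto the class of
  \<open>\<lambda>_b(x)\<close>, so each of these classes is finite if \<open>x \<in> FC(B,+)\<close>.

  For a group that acts by automorphisms, the elements with a finite orbit form an invariant
  subgroup, because the orbit of \<open>x + y\<close> lies in the sum of the orbits of \<open>x\<close> and \<open>y\<close>.
  Invariance under \<open>\<theta>\<close> contains normality and invariance under \<open>\<lambda>\<close>.

  Finally, an epimorphism maps the \<open>\<theta>\<close>-orbit of \<open>x\<close> onto the \<open>\<theta>\<close>-orbit of its image.
\<close>

section \<open>The additive group\<close>

context skew_brace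
begin

lemma add_closed [simp, intro]:
  "a \<in> carrier B \<Longrightarrow> b \<in> carrier B \<Longrightarrow> a \<oplus> b \<in> carrier B"
  using add.m_closed by simp

lemma neg_closed [simp, intro]: "a \<in> carrier B \<Longrightarrow> \<ominus> a \<in> carrier B"
  using add.inv_closed by (simp add: a_inv_def)

lemma zero_closed [simp, intro]: "\<zero> \<in> carrier B"
  using add.one_closed by simp

lemma add_assoc:
  "a \<in> carrier B \<Longrightarrow> b \<in> carrier B \<Longrightarrow> c \<in> carrier B \<Longrightarrow> (a \<oplus> b) \<oplus> c = a \<oplus> (b \<oplus> c)"
  using add.m_assoc by simp

lemma zero_add [simp]: "a \<in> carrier B \<Longrightarrow> \<zero> \<oplus> a = a"
  using add.l_one by simp

lemma add_zero [simp]: "a \<in> carrier B \<Longrightarrow> a \<oplus> \<zero> = a"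
  using add.r_one by simp

lemma neg_add_self [simp]: "a \<in> carrier B \<Longrightarrow> \<ominus> a \<oplus> a = \<zero>"
  using add.l_inv by (simp add: a_inv_def)

lemma add_neg_self [simp]: "a \<in> carrier B \<Longrightarrow> a \<oplus> \<ominus> a = \<zero>"
  using add.r_inv by (simp add: a_inv_def)

lemma neg_add_cancel [simp]:
  "a \<in> carrier B \<Longrightarrow> b \<in> carrier B \<Longrightarrow> \<ominus> a \<oplus> (a \<oplus> b) = b"
  by (simp flip: add_assoc)

lemma add_neg_cancel [simp]:
  "a \<in> carrier B \<Longrightarrow> b \<in> carrier B \<Longrightarrow> a \<oplus> (\<ominus> a \<oplus> b) = b"
  by (simp flip: add_assoc)

lemma neg_zero [simp]: "\<ominus> \<zero> = \<zero>"
  using add.inv_one by (simp add: a_inv_def)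

lemma neg_neg [simp]: "a \<in> carrier B \<Longrightarrow> \<ominus> (\<ominus> a) = a"
  using add.inv_inv by (simp add: a_inv_def)

lemma neg_add:
  "a \<in> carrier B \<Longrightarrow> b \<in> carrier B \<Longrightarrow> \<ominus> (a \<oplus> b) = \<ominus> b \<oplus> \<ominus> a"
  using add.inv_mult_group by (simp add: a_inv_def)

lemma neg_unique: "a \<in> carrier B \<Longrightarrow> b \<in> carrier B \<Longrightarrow> a \<oplus> b = \<zero> \<Longrightarrow> b = \<ominus> a"
  by (metis neg_add_cancel add_zero neg_closed)


section \<open>The action \<open>\<lambda>\<close>\<close>

text \<open>Distributivity at \<open>b = c = 0\<close> gives \<open>a \<circ> 0 = a\<close>, so \<open>0\<close> is neutral for \<open>\<circ>\<close> too.\<close>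

lemma mult_zero [simp]: assumes "a \<in> carrier B" shows "a \<otimes> \<zero> = a"
proof -
  have "a \<otimes> \<zero> = a \<otimes> \<zero> \<oplus> (\<ominus> a \<oplus> a \<otimes> \<zero>)"
    using skew_distrib[of a \<zero> \<zero>] assms by (simp add: a_minus_def add_assoc)
  then have "\<ominus> (a \<otimes> \<zero>) \<oplus> a \<otimes> \<zero> = \<ominus> a \<oplus> a \<otimes> \<zero>"
    using assms by (metis neg_add_cancel neg_closed add_closed m_closed zero_closed)
  then have "\<ominus> a \<oplus> a \<otimes> \<zero> = \<zero>"
    using assms by simp
  then show ?thesis
    using assms neg_unique[of "\<ominus> a" "a \<otimes> \<zero>"] by simp
qed

lemma one_eq_zero: "\<one> = \<zero>"
  using mult_zero[of \<one>] by simp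

lemma lambda_closed [simp, intro]:
  "a \<in> carrier B \<Longrightarrow> x \<in> carrier B \<Longrightarrow> brace_lambda B a x \<in> carrier B"
  by (simp add: brace_lambda_def)

text \<open>Skew distributivity is exactly additivity of \<open>\<lambda>_a\<close>, multiplied on the left by \<open>a\<close>.\<close>

lemma lambda_add:
  assumes "a \<in> carrier B" "x \<in> carrier B" "y \<in> carrier B"
  shows "brace_lambda B a (x \<oplus> y) = brace_lambda B a x \<oplus> brace_lambda B a y"
  using assms by (simp add: brace_lambda_def skew_distrib a_minus_def add_assoc)

lemma lambda_zero [simp]: "a \<in> carrier B \<Longrightarrow> brace_lambda B a \<zero> = \<zero>"
  by (simp add: brace_lambda_def)

lemma lambda_neg:
  assumes "a \<in> carrier B" "x \<in> carrier B"
  shows "brace_lambda B a (\<ominus> x) = \<ominus> brace_lambda B a x"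
  using assms by (intro neg_unique) (simp_all flip: lambda_add)

lemma lambda_one [simp]: "x \<in> carrier B \<Longrightarrow> brace_lambda B \<one> x = x"
  by (simp add: brace_lambda_def) (simp add: one_eq_zero)

text \<open>
  Writing \<open>\<lambda>_b(x) = -b + b \<circ> x\<close> and applying the additive map \<open>\<lambda>_a\<close> reduces the composition law to
  associativity of \<open>\<circ>\<close>, since \<open>-\<lambda>_a(b) + \<lambda>_a(b \<circ> x) = -(a \<circ> b) + a - a + a \<circ> (b \<circ> x)\<close>.
\<close>

lemma lambda_mult:
  assumes "a \<in> carrier B" "b \<in> carrier B" "x \<in> carrier B"
  shows "brace_lambda B a (brace_lambda B b x) = brace_lambda B (a \<otimes> b) x"
proof -
  have "brace_lambda B a (brace_lambda B b x)
      = \<ominus> brace_lambda B a b \<oplus> brace_lambda B a (b \<otimes> x)"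
    using assms by (simp add: brace_lambda_def[of B b] lambda_add lambda_neg)
  also have "\<dots> = brace_lambda B (a \<otimes> b) x"
    using assms by (simp add: brace_lambda_def neg_add add_assoc m_assoc)
  finally show ?thesis .
qed

lemma lambda_inv_cancel [simp]:
  "a \<in> carrier B \<Longrightarrow> x \<in> carrier B \<Longrightarrow> brace_lambda B a (brace_lambda B (inv a) x) = x"
  by (simp add: lambda_mult)


section \<open>The action \<open>\<theta>\<close>\<close>

lemma theta_eq: "brace_theta B (a, b) x = a \<oplus> brace_lambda B b x \<oplus> \<ominus> a"
  by (simp add: brace_theta_def a_minus_def)

lemma theta_closed [simp, intro]:
  "a \<in> carrier B \<Longrightarrow> b \<in> carrier B \<Longrightarrow> x \<in> carrier B \<Longrightarrow> brace_theta B (a, b) x \<in> carrier B"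
  by (simp add: theta_eq)

lemma theta_zero_left: "b \<in> carrier B \<Longrightarrow> x \<in> carrier B
    \<Longrightarrow> brace_theta B (\<zero>, b) x = brace_lambda B b x"
  by (simp add: theta_eq)

lemma theta_one_right: "x \<in> carrier B \<Longrightarrow> brace_theta B (a, \<one>) x = a \<oplus> x \<oplus> \<ominus> a"
  by (simp add: theta_eq)

lemma theta_add:
  assumes "a \<in> carrier B" "b \<in> carrier B" "x \<in> carrier B" "y \<in> carrier B"
  shows "brace_theta B (a, b) (x \<oplus> y) = brace_theta B (a, b) x \<oplus> brace_theta B (a, b) y"
  using assms by (simp add: theta_eq lambda_add add_assoc)

lemma theta_neg:
  assumes "a \<in> carrier B" "b \<in> carrier B" "x \<in> carrier B"
  shows "brace_theta B (a, b) (\<ominus> x) = \<ominus> brace_theta B (a, b) x"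
  using assms by (simp add: theta_eq lambda_neg neg_add add_assoc)

text \<open>
  The index on the right-hand side is the product of \<open>(a, b)\<close> and \<open>(c, d)\<close> in the semidirect product.
\<close>

lemma theta_theta:
  assumes "a \<in> carrier B" "b \<in> carrier B" "c \<in> carrier B" "d \<in> carrier B" "x \<in> carrier B"
  shows "brace_theta B (a, b) (brace_theta B (c, d) x)
       = brace_theta B (a \<oplus> brace_lambda B b c, b \<otimes> d) x"
  using assms by (simp add: theta_eq lambda_add lambda_neg lambda_mult neg_add add_assoc)


section \<open>Elements with a finite \<open>\<theta>\<close>-orbit\<close>

definition theta_orbit :: "'a \<Rightarrow> 'a set" where
  "theta_orbit x = {brace_theta B (a, b) x | a b. a \<in> carrier B \<and> b \<in> carrier B}"

lemma theta_f_iff: "x \<in> theta_f B \<longleftrightarrow> x \<in> carrier B \<and> finite (theta_orbit x)"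
  by (simp add: theta_f_def theta_orbit_def)

lemma FC_iff:
  "x \<in> FC (add_monoid B) \<longleftrightarrow>
    x \<in> carrier B \<and> finite ((\<lambda>a. a \<oplus> x \<oplus> \<ominus> a) ` carrier B)"
  by (simp add: FC_def a_inv_def image_def Setcompr_eq_image)

lemma lambda_f_iff:
  "x \<in> lambda_f B \<longleftrightarrow>
    x \<in> carrier B \<and> finite ((\<lambda>b. brace_lambda B b x) ` carrier B)"
  by (simp add: lambda_f_def Setcompr_eq_image)

text \<open>
  The left-to-right inclusion restricts \<open>\<theta>\<close> to \<open>a = 0\<close> and to \<open>b = 1\<close>.  For the other, finiteness
  of the conjugacy class has to be carried from \<open>x\<close> to every \<open>\<lambda>_b(x)\<close>, which works because \<open>\<lambda>_b\<close>
  is an automorphism of \<open>(B,+)\<close>.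
\<close>

lemma theta_f_eq: "theta_f B = lambda_f B \<inter> FC (add_monoid B)"
proof (intro equalityI subsetI)
  fix x assume "x \<in> theta_f B"
  then have x: "x \<in> carrier B" and fin: "finite (theta_orbit x)"
    by (auto simp: theta_f_iff)
  have "(\<lambda>b. brace_lambda B b x) ` carrier B \<subseteq> theta_orbit x"
    using x by (force simp: theta_orbit_def theta_zero_left[symmetric])
  moreover have "(\<lambda>a. a \<oplus> x \<oplus> \<ominus> a) ` carrier B \<subseteq> theta_orbit x"
    using x by (force simp: theta_orbit_def theta_one_right[symmetric])
  ultimately show "x \<in> lambda_f B \<inter> FC (add_monoid B)"
    using x fin by (auto simp: lambda_f_iff FC_iff dest: finite_subset)
next
  fix x assume "x \<in> lambda_f B \<inter> FC (add_monoid B)"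
  then have x: "x \<in> carrier B"
    and fin_lambda: "finite ((\<lambda>b. brace_lambda B b x) ` carrier B)"
    and fin_conj: "finite ((\<lambda>a. a \<oplus> x \<oplus> \<ominus> a) ` carrier B)"
    by (auto simp: lambda_f_iff FC_iff)
  define conj_class where "conj_class y = (\<lambda>a. a \<oplus> y \<oplus> \<ominus> a) ` carrier B" for y
  have "finite (conj_class (brace_lambda B b x))" if b: "b \<in> carrier B" for b
  proof -
    have "conj_class (brace_lambda B b x) \<subseteq> brace_lambda B b ` conj_class x"
    proof
      fix z assume "z \<in> conj_class (brace_lambda B b x)"
      then obtain a where a: "a \<in> carrier B" and z: "z = a \<oplus> brace_lambda B b x \<oplus> \<ominus> a"
        by (auto simp: conj_class_def)
      \<comment> \<open>Solves \<open>\<lambda>_b(c) = a\<close>, so that \<open>\<lambda>_b\<close> carries conjugation by \<open>c\<close> to conjugation by \<open>a\<close>.\<close>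
      let ?c = "brace_lambda B (inv b) a"
      have "z = brace_lambda B b (?c \<oplus> x \<oplus> \<ominus> ?c)"
        using a b x z by (simp add: lambda_add lambda_neg)
      then show "z \<in> brace_lambda B b ` conj_class x"
        using a b by (auto simp: conj_class_def)
    qed
    then show ?thesis
      using fin_conj by (auto simp: conj_class_def intro: finite_subset)
  qed
  moreover have "theta_orbit x
      = (\<Union>y \<in> (\<lambda>b. brace_lambda B b x) ` carrier B. conj_class y)"
    by (auto simp: theta_orbit_def conj_class_def theta_eq)
  ultimately have "finite (theta_orbit x)"
    using fin_lambda by (metis (no_types, lifting) finite_UN_I imageE)
  then show "x \<in> theta_f B"
    using x by (simp add: theta_f_iff)
qed

text \<open>
  The next two lemmas use that each \<open>\<theta>_(a,b)\<close> is additive: it takes \<open>x + y\<close> to the sum of a point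
  of the orbit of \<open>x\<close> and a point of the orbit of \<open>y\<close>, and \<open>-x\<close> to the negative of a point of the
  orbit of \<open>x\<close>.
\<close>

lemma theta_f_add:
  assumes "x \<in> theta_f B" "y \<in> theta_f B"
  shows "x \<oplus> y \<in> theta_f B"
proof -
  have "theta_orbit (x \<oplus> y) \<subseteq> (\<lambda>(u, v). u \<oplus> v) ` (theta_orbit x \<times> theta_orbit y)"
    using assms by (fastforce simp: theta_orbit_def theta_f_iff theta_add)
  then show ?thesis
    using assms by (auto simp: theta_f_iff intro: finite_subset)
qed

lemma theta_f_neg:
  assumes "x \<in> theta_f B"
  shows "\<ominus> x \<in> theta_f B"
proof -
  have "theta_orbit (\<ominus> x) \<subseteq> (\<lambda>u. \<ominus> u) ` theta_orbit x"
    using assms by (force simp: theta_orbit_def theta_f_iff theta_neg)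
  then show ?thesis
    using assms by (auto simp: theta_f_iff intro: finite_subset)
qed

text \<open>By the composition law, a point of the orbit of \<open>x\<close> has its own orbit inside that of \<open>x\<close>.\<close>

lemma theta_f_theta:
  assumes "a \<in> carrier B" "b \<in> carrier B" "x \<in> theta_f B"
  shows "brace_theta B (a, b) x \<in> theta_f B"
proof -
  have "theta_orbit (brace_theta B (a, b) x) \<subseteq> theta_orbit x"
    using assms by (force simp: theta_orbit_def theta_f_iff theta_theta)
  then show ?thesis
    using assms by (auto simp: theta_f_iff intro: finite_subset)
qed

lemma zero_in_theta_f: "\<zero> \<in> theta_f B"
proof -
  have "theta_orbit \<zero> \<subseteq> {\<zero>}"
    by (auto simp: theta_orbit_def theta_eq)
  then show ?thesis
    by (auto simp: theta_f_iff intro: finite_subset)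
qed

lemma theta_f_lambda:
  "b \<in> carrier B \<Longrightarrow> x \<in> theta_f B \<Longrightarrow> brace_lambda B b x \<in> theta_f B"
  using theta_f_theta[of \<zero> b x] by (simp add: theta_zero_left theta_f_iff)

text \<open>
  Conjugation and \<open>\<lambda>\<close> are both instances of \<open>\<theta>\<close>, so both preserve \<open>\<theta>_f(B)\<close>.  Equality
  \<open>\<lambda>_b(\<theta>_f(B)) = \<theta>_f(B)\<close>, rather than an inclusion, comes from invariance under the inverse of
  \<open>\<lambda>_b\<close>, which is again a \<open>\<lambda>\<close>-map.
\<close>

lemma theta_f_strong_left_ideal: "strong_left_ideal (theta_f B) B"
proof -
  have sub: "subgroup (theta_f B) (add_monoid B)"
  proof (rule add.subgroupI)
    show "theta_f B \<subseteq> carrier (add_monoid B)"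
      by (auto simp: theta_f_iff)
    show "theta_f B \<noteq> {}"
      using zero_in_theta_f by blast
  qed (simp_all add: theta_f_add theta_f_neg flip: a_inv_def)
  have "a \<oplus> x \<oplus> \<ominus> a \<in> theta_f B" if "a \<in> carrier B" "x \<in> theta_f B" for a x
    using theta_f_theta[of a \<one> x] that by (simp add: theta_one_right theta_f_iff)
  then have "theta_f B \<lhd> add_monoid B"
    using sub by (simp add: add.normal_inv_iff a_inv_def)
  moreover have "brace_lambda B b ` theta_f B = theta_f B" if b: "b \<in> carrier B" for b
  proof (intro equalityI subsetI)
    fix x assume "x \<in> theta_f B"
    then have "brace_lambda B (inv b) x \<in> theta_f B"
      and "x = brace_lambda B b (brace_lambda B (inv b) x)"
      using b by (simp_all add: theta_f_lambda) (simp add: theta_f_iff)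
    then show "x \<in> brace_lambda B b ` theta_f B"
      by (rule rev_image_eqI)
  qed (use b in \<open>auto simp: theta_f_lambda\<close>)
  ultimately show ?thesis
    by (simp add: strong_left_ideal_def)
qed

end


section \<open>Images under morphisms\<close>

lemma brace_hom_theta:
  assumes "skew_brace B" "skew_brace C" "\<phi> \<in> brace_hom B C"
    and "a \<in> carrier B" "b \<in> carrier B" "x \<in> carrier B"
  shows "\<phi> (brace_theta B (a, b) x) = brace_theta C (\<phi> a, \<phi> b) (\<phi> x)"
proof -
  interpret B: skew_brace B by fact
  interpret C: skew_brace C by fact
  have add: "\<phi> (u \<oplus>\<^bsub>B\<^esub> v) = \<phi> u \<oplus>\<^bsub>C\<^esub> \<phi> v"
    and mult: "\<phi> (u \<otimes>\<^bsub>B\<^esub> v) = \<phi> u \<otimes>\<^bsub>C\<^esub> \<phi> v" if "u \<in> carrier B" "v \<in> carrier B" for u v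
    using assms(3) that by (auto simp: brace_hom_def hom_def)
  interpret group_hom "add_monoid B" "add_monoid C" \<phi>
    using assms(3) by unfold_locales (simp add: brace_hom_def)
  have neg: "\<phi> (\<ominus>\<^bsub>B\<^esub> u) = \<ominus>\<^bsub>C\<^esub> \<phi> u" if "u \<in> carrier B" for u
    using hom_inv[of u] that by (simp add: a_inv_def)
  show ?thesis
    using assms(4-6) by (simp add: B.theta_eq C.theta_eq brace_lambda_def add mult neg)
qed

text \<open>
  Surjectivity lets every index \<open>(c, d)\<close> of \<open>C\<close> be lifted to \<open>B\<close>, so the orbit of \<open>\<phi>(x)\<close> contains
  nothing beyond the image of the orbit of \<open>x\<close>.
\<close>

lemma brace_epi_theta_f:
  assumes "skew_brace B" "skew_brace C" "\<phi> \<in> brace_epi B C"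
  shows "\<phi> ` theta_f B \<subseteq> theta_f C"
proof
  interpret B: skew_brace B by fact
  interpret C: skew_brace C by fact
  have hom: "\<phi> \<in> brace_hom B C" and surj: "\<phi> ` carrier B = carrier C"
    using assms(3) by (auto simp: brace_epi_def)
  fix y assume "y \<in> \<phi> ` theta_f B"
  then obtain x where x: "x \<in> carrier B" "finite (B.theta_orbit x)" and y: "y = \<phi> x"
    by (auto simp: B.theta_f_iff)
  have "C.theta_orbit y \<subseteq> \<phi> ` B.theta_orbit x"
  proof
    fix z assume "z \<in> C.theta_orbit y"
    then obtain c d where "c \<in> carrier C" "d \<in> carrier C" and z: "z = brace_theta C (c, d) y"
      by (auto simp: C.theta_orbit_def)
    then obtain a b where ab: "a \<in> carrier B" "b \<in> carrier B" "c = \<phi> a" "d = \<phi> b"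
      using surj by blast
    then have "z = \<phi> (brace_theta B (a, b) x)"
      using brace_hom_theta[OF assms(1,2) hom] x y z by simp
    then show "z \<in> \<phi> ` B.theta_orbit x"
      using ab by (auto simp: B.theta_orbit_def)
  qed
  then show "y \<in> theta_f C"
    using x y surj by (auto simp: C.theta_f_iff intro: finite_subset)
qed

theorem proposition5p8:
  fixes B :: "('a, 'm) ring_scheme"
  assumes "skew_brace B"
  shows "theta_f B = lambda_f B \<inter> FC (add_monoid B)
    \<and> strong_left_ideal (theta_f B) B
    \<and> (\<forall>(C :: ('b, 'n) ring_scheme) \<phi>. skew_brace C \<longrightarrow> \<phi> \<in> brace_epi B C
          \<longrightarrow> \<phi> ` theta_f B \<subseteq> theta_f C)"
  using skew_brace.theta_f_eq[OF assms] skew_brace.theta_f_strong_left_ideal[OF assms]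
    brace_epi_theta_f[OF assms]
  by blast

end
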